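(* Let $\lambda\in[0,\infty)$ and fix any pair $(\phi,\phi_s)$ with $\phi\in(0,\infty)$ and $\phi_s\ge\phi$. Then for all $M\in\{1,\dots,\lfloor\phi_s/\phi\rfloor\}$, $$\mathscr B^{\mathrm{spl}}_{\lambda,\lfloor\phi_s/\phi\rfloor}(\phi,\phi_s)\le\mathscr B^{\mathrm{spl}}_{\lambda,M+1}(\phi,\phi_s)\le\mathscr B^{\mathrm{spl}}_{\lambda,M}(\phi,\phi_s),$$ $$\mathscr V^{\mathrm{spl}}_{\lambda,\lfloor\phi_s/\phi\rfloor}(\phi,\phi_s)\le\mathscr V^{\mathrm{spl}}_{\lambda,M+1}(\phi,\phi_s)\le\mathscr V^{\mathrm{spl}}_{\lambda,M}(\phi,\phi_s).$$ The inequalities for $\mathscr B^{\mathrm{spl}}$ are strict whenever $\rho^2>0$ and $\phi_s\in(\phi,\infty)$ (and $\phi_s\ne1$ when $\lambda=0$), while the inequalities for $\mathscr V^{\mathrm{spl}}$ are strict when $\sigma^2>0$ and $\phi_s\in(\phi,\infty)$ (and $\phi_s\ne1$ when $\lambda=0$). Thus, the asymptotic risk is monotonically decreasing in $M$, i.e., $\mathscr R^{\mathrm{spl}}_{\lambda,M+1}(\phi,\phi_s)\le\mathscr R^{\mathrm{spl}}_{\lambda,M}(\phi,\phi_s)$.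
   Context: Let $0<r_{\min}\le r_{\max}<\infty$, let $H,G$ be probability measures supported on $[r_{\min},r_{\max}]$ (limiting spectral distribution of the feature covariance and limiting signal-weighted spectral distribution), and let $\rho^2,\sigma^2\ge0$ be finite (signal energy, noise variance). Here $\phi$ is the limiting ratio of number of features to number of observations, $\phi_s$ the limiting ratio of number of features to the size of each split, and $M$ the number of bags; $\mathscr R^{\mathrm{spl}}_{\lambda,M}$ is the asymptotic prediction risk of the average of $M$ ridge (ridgeless if $\lambda=0$) predictors fitted on non-overlapping splits of the data, with bias and variance components $\mathscr B^{\mathrm{spl}}_{\lambda,M}$, $\mathscr V^{\mathrm{spl}}_{\lambda,M}$, defined as follows. For $\lambda>0,\theta\in(0,\infty)$, $v(-\lambda;\theta)$ is the unique nonnegative solution of $\frac1{v}=\lambda+\theta\int\frac{r}{1+vr}dH(r)$; $v(0;\theta)=\lim_{\lambda\to0^+}v(-\lambda;\theta)$ if $\theta>1$ and $+\infty$ if $\theta\in(0,1]$. With $v=v(-\lambda;\theta)$, $$\widetilde v(-\lambda;\vartheta,\theta)=\frac{\vartheta\int r^2(1+vr)^{-2}dH(r)}{v^{-2}-\vartheta\int r^2(1+vr)^{-2}dH(r)},\qquad \widetilde c(-\lambda;\theta)=\int\frac{r}{(1+vr)^2}dG(r).$$ At $\theta=\infty$: $v=0$, $\widetilde v=0$, $\widetilde c=\int r\,dG(r)$ (limits as $\theta\to\infty$). For $\vartheta\le\theta$, $B_\lambda(\vartheta,\theta)=\rho^2(1+\widetilde v(-\lambda;\vartheta,\theta))\widetilde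 c(-\lambda;\theta)$, $V_\lambda(\vartheta,\theta)=\sigma^2\widetilde v(-\lambda;\vartheta,\theta)$, $C_\lambda(\theta)=\rho^2\widetilde c(-\lambda;\theta)$; for $\lambda=0$ and $\theta\le1$ these are read as $B_0(\vartheta,\theta)=C_0(\theta)=0$ for $\theta\in(0,1]$, $V_0(\vartheta,\theta)=\sigma^2\vartheta/(1-\vartheta)$ for $\theta\in(0,1)$, and $V_0(\vartheta,1)=\infty$. For $M\in\mathbb N$ with $M\le\lfloor\phi_s/\phi\rfloor$: $\mathscr B^{\mathrm{spl}}_{\lambda,M}(\phi,\phi_s)=M^{-1}B_\lambda(\phi_s,\phi_s)+(1-M^{-1})C_\lambda(\phi_s)$, $\mathscr V^{\mathrm{spl}}_{\lambda,M}(\phi,\phi_s)=M^{-1}V_\lambda(\phi_s,\phi_s)$, $\mathscr R^{\mathrm{spl}}_{\lambda,M}=\sigma^2+\mathscr B^{\mathrm{spl}}_{\lambda,M}+\mathscr V^{\mathrm{spl}}_{\lambda,M}$. For $M\ge\lfloor\phi_s/\phi\rfloor$ all three are equal to their values at $M=\lfloor\phi_s/\phi\rfloor$.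
   Formalization: With N=⌊φ_s/φ⌋, strictness is claimed only for M+1<N (first inequalities) and M<N (second ones), since B and V are constant in M from N on; for B with λ=0 the condition φ_s≠1 becomes φ_s>1, because B is identically 0 when λ=0 and φ_s≤1. *)

theory Defs
  imports "HOL-Probability.Probability"
begin

text \<open>
  The argument \<open>lam\<close> is the ridge penalty itself, so \<open>ridge_v H lam \<theta>\<close> is
  \<open>v(-lam; \<theta>)\<close>, and similarly for the other functionals; in
  two-argument functionals \<open>\<theta>'\<close> precedes \<open>\<theta>\<close>, with \<open>\<theta>' \<le> \<theta>\<close>.
\<close>

text \<open>
  The case \<open>lam > 0\<close>, \<open>\<theta> < \<infinity>\<close>. The convention \<open>1 / 0 = 0\<close> adds no spurious solution \<open>v = 0\<close>:
  for \<open>H\<close> supported on the positive half-line the right-hand side is positive.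
\<close>
definition ridge_v_pos :: "real measure \<Rightarrow> real \<Rightarrow> real \<Rightarrow> real" where
  "ridge_v_pos H lam \<theta> =
     (THE v. 0 \<le> v \<and> 1 / v = lam + \<theta> * (\<integral>r. r / (1 + v * r) \<partial>H))"

definition ridge_v :: "real measure \<Rightarrow> real \<Rightarrow> ereal \<Rightarrow> ereal" where
  "ridge_v H lam \<theta> =
     (if \<theta> = \<infinity> then 0
      else if lam > 0 then ereal (ridge_v_pos H lam (real_of_ereal \<theta>))
      else if \<theta> \<le> 1 then \<infinity>
      else ereal (Lim (at_right 0) (\<lambda>l. ridge_v_pos H l (real_of_ereal \<theta>))))"

text \<open>
  \<open>ridge_v_tilde\<close> and \<open>ridge_c_tilde\<close> are meaningful only when \<open>ridge_v\<close> is finite; the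
  components below use separate values when \<open>lam = 0\<close> and \<open>\<theta> \<le> 1\<close>. At \<open>\<theta> = \<infinity>\<close> one has \<open>v = 0\<close>,
  so that \<open>ridge_c_tilde\<close> is the first moment of \<open>G\<close>, whereas \<open>v\<close> to the power \<open>-2\<close> makes no sense
  and \<open>ridge_v_tilde\<close> takes its limit \<open>0\<close>.
\<close>
definition ridge_v_tilde :: "real measure \<Rightarrow> real \<Rightarrow> ereal \<Rightarrow> ereal \<Rightarrow> real" where
  "ridge_v_tilde H lam \<theta>' \<theta> =
     (if \<theta> = \<infinity> then 0
      else let v = real_of_ereal (ridge_v H lam \<theta>);
               I = real_of_ereal \<theta>' * (\<integral>r. r\<^sup>2 / (1 + v * r)\<^sup>2 \<partial>H)
           in I / (1 / v\<^sup>2 - I))"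

definition ridge_c_tilde :: "real measure \<Rightarrow> real measure \<Rightarrow> real \<Rightarrow> ereal \<Rightarrow> real" where
  "ridge_c_tilde H G lam \<theta> =
     (let v = real_of_ereal (ridge_v H lam \<theta>) in \<integral>r. r / (1 + v * r)\<^sup>2 \<partial>G)"

text \<open>The components take values in \<^typ>\<open>ereal\<close> because \<open>V\<close> is infinite at \<open>lam = 0\<close>, \<open>\<theta> = 1\<close>.\<close>

definition B_comp ::
    "real measure \<Rightarrow> real measure \<Rightarrow> real \<Rightarrow> real \<Rightarrow> ereal \<Rightarrow> ereal \<Rightarrow> ereal" where
  "B_comp H G \<rho> lam \<theta>' \<theta> =
     (if lam = 0 \<and> \<theta> \<le> 1 then 0
      else ereal (\<rho>\<^sup>2 * (1 + ridge_v_tilde H lam \<theta>' \<theta>) * ridge_c_tilde H G lam \<theta>))"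

definition C_comp :: "real measure \<Rightarrow> real measure \<Rightarrow> real \<Rightarrow> real \<Rightarrow> ereal \<Rightarrow> ereal" where
  "C_comp H G \<rho> lam \<theta> =
     (if lam = 0 \<and> \<theta> \<le> 1 then 0 else ereal (\<rho>\<^sup>2 * ridge_c_tilde H G lam \<theta>))"

definition V_comp :: "real measure \<Rightarrow> real \<Rightarrow> real \<Rightarrow> ereal \<Rightarrow> ereal \<Rightarrow> ereal" where
  "V_comp H \<sigma> lam \<theta>' \<theta> =
     (if lam = 0 \<and> \<theta> = 1 then \<infinity>
      else if lam = 0 \<and> \<theta> < 1
        then ereal (\<sigma>\<^sup>2 * (real_of_ereal \<theta>' / (1 - real_of_ereal \<theta>')))
      else ereal (\<sigma>\<^sup>2 * ridge_v_tilde H lam \<theta>' \<theta>))"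

definition num_splits :: "real \<Rightarrow> ereal \<Rightarrow> enat" where
  "num_splits \<phi> \<phi>s =
     (if \<phi>s = \<infinity> then \<infinity> else enat (nat \<lfloor>real_of_ereal \<phi>s / \<phi>\<rfloor>))"

text \<open>
  The number of bags \<open>M\<close> ranges over \<^typ>\<open>enat\<close> because \<open>num_splits\<close> is infinite at
  \<open>\<phi>s = \<infinity>\<close>; the weight \<open>1 / M\<close> is then \<open>0\<close>. Taking the minimum makes the values constant
  from \<open>M = num_splits \<phi> \<phi>s\<close> on.
\<close>
definition B_spl ::
    "real measure \<Rightarrow> real measure \<Rightarrow> real \<Rightarrow> real \<Rightarrow> enat \<Rightarrow> real \<Rightarrow> ereal \<Rightarrow> ereal" where
  "B_spl H G \<rho> lam M \<phi> \<phi>s =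
     (let w = inverse (ereal_of_enat (min M (num_splits \<phi> \<phi>s)))
      in w * B_comp H G \<rho> lam \<phi>s \<phi>s + (1 - w) * C_comp H G \<rho> lam \<phi>s)"

definition V_spl :: "real measure \<Rightarrow> real \<Rightarrow> real \<Rightarrow> enat \<Rightarrow> real \<Rightarrow> ereal \<Rightarrow> ereal" where
  "V_spl H \<sigma> lam M \<phi> \<phi>s =
     inverse (ereal_of_enat (min M (num_splits \<phi> \<phi>s))) * V_comp H \<sigma> lam \<phi>s \<phi>s"

definition R_spl ::
    "real measure \<Rightarrow> real measure \<Rightarrow> real \<Rightarrow> real \<Rightarrow> real \<Rightarrow> enat \<Rightarrow> real \<Rightarrow> ereal \<Rightarrow> ereal" where
  "R_spl H G \<rho> \<sigma> lam M \<phi> \<phi>s =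
     ereal (\<sigma>\<^sup>2) + B_spl H G \<rho> lam M \<phi> \<phi>s + V_spl H \<sigma> lam M \<phi> \<phi>s"

end

theory Submission
  imports Defs
begin

text \<open>
  As a function of the number of bags \<open>M\<close>, the bias is \<open>C + (B - C) / M\<close> and the variance is
  \<open>V / M\<close>, with \<open>M\<close> capped at the number of available splits. Both are therefore nonincreasing in
  \<open>M\<close> as soon as \<open>C \<le> B\<close> and \<open>0 \<le> V\<close>, and strictly decreasing up to the cap as soon as these
  two inequalities are strict and \<open>V\<close> is finite.

  Since \<open>B - C = \<rho>\<^sup>2 \<sqdot> v_tilde \<sqdot> c_tilde\<close> and \<open>V = \<sigma>\<^sup>2 \<sqdot> v_tilde\<close> (outside the degenerate range
  \<open>lam = 0\<close>, \<open>\<theta> \<le> 1\<close>), everything rests on the positivity of \<open>v_tilde\<close> and \<open>c_tilde\<close>. For \<open>c_tilde\<close>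
  it is clear. For \<open>v_tilde\<close> the denominator \<open>v\<^sup>-\<^sup>2 - \<theta> \<integral> r\<^sup>2 / (1 + v r)\<^sup>2 dH\<close> has to be positive.
  Multiplying the fixed-point equation by \<open>v\<close> turns it into
  \<open>lam \<sqdot> v + \<theta> \<integral> v r / (1 + v r) dH = 1\<close>, so that the values \<open>s = v r / (1 + v r)\<close>, which stay away
  from \<open>1\<close>, satisfy \<open>\<theta> \<integral> s dH \<le> 1\<close>; hence \<open>\<theta> \<integral> s\<^sup>2 dH < 1\<close>, which is the claim
  (\<open>ridge_root_denominator\<close>).

  The remaining point is that the \<open>v\<close> given by a definite description (for \<open>lam > 0\<close>) or by
  a limit (for \<open>lam = 0\<close>, \<open>\<theta> > 1\<close>) really solves this equation. The left-hand side is
  Lipschitz and strictly increasing in \<open>v\<close>, vanishes at \<open>0\<close> and, if \<open>lam > 0\<close> or \<open>\<theta> > 1\<close>, reaches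
  \<open>1\<close>, whence a unique root (\<open>ex_ridge_root\<close>, \<open>ridge_root_unique\<close>); a lower bound for its slope
  shows that the roots for \<open>lam > 0\<close> tend to the root for \<open>lam = 0\<close>.
\<close>

section \<open>Integrals against a spectral distribution\<close>

lemma div_one_plus_mono:
  fixes x y :: real
  assumes "0 \<le> x" "x \<le> y"
  shows "x / (1 + x) \<le> y / (1 + y)"
  using assms by (simp add: divide_simps algebra_simps)

locale bounded_spectrum = real_distribution M for M +
  fixes a b :: real
  assumes a_pos: "0 < a" and a_le_b: "a \<le> b" and AE_range: "AE r in M. r \<in> {a..b}"
begin

lemma integrable_bounded_on_range:
  fixes f :: "real \<Rightarrow> real"
  assumes "f \<in> borel_measurable borel" and "\<And>r. a \<le> r \<Longrightarrow> r \<le> b \<Longrightarrow> \<bar>f r\<bar> \<le> K"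
  shows "integrable M f"
proof (rule integrable_const_bound[where B = K])
  show "AE r in M. norm (f r) \<le> K"
    using AE_range by eventually_elim (use assms(2) in auto)
  show "f \<in> borel_measurable M"
    using assms(1) by simp
qed

lemma integral_mono_on_range:
  fixes f g :: "real \<Rightarrow> real"
  assumes "integrable M f" "integrable M g"
    and "\<And>r. a \<le> r \<Longrightarrow> r \<le> b \<Longrightarrow> f r \<le> g r"
  shows "integral\<^sup>L M f \<le> integral\<^sup>L M g"
  using assms(1,2)
proof (rule integral_mono_AE)
  show "AE r in M. f r \<le> g r"
    using AE_range by eventually_elim (use assms(3) in auto)
qed

lemma integral_ge_const_on_range:
  fixes f :: "real \<Rightarrow> real"
  assumes "integrable M f" and "\<And>r. a \<le> r \<Longrightarrow> r \<le> b \<Longrightarrow> K \<le> f r"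
  shows "K \<le> integral\<^sup>L M f"
proof -
  have "integral\<^sup>L M (\<lambda>_. K) \<le> integral\<^sup>L M f"
    by (rule integral_mono_on_range) (use assms in auto)
  then show ?thesis
    by (simp add: prob_space[simplified])
qed

lemma integral_pos_on_range:
  fixes f :: "real \<Rightarrow> real"
  assumes "integrable M f" and "0 < K" and "\<And>r. a \<le> r \<Longrightarrow> r \<le> b \<Longrightarrow> K \<le> f r"
  shows "0 < integral\<^sup>L M f"
  using integral_ge_const_on_range[OF assms(1,3)] assms(2) by linarith

text \<open>
  The integrals in the fixed-point equation, in \<open>v_tilde\<close> and in \<open>c_tilde\<close> have
  integrands \<open>r ^ m / (1 + v r) ^ n\<close>, which on the range of the spectrum lie between the
  positive constants \<open>a ^ m / (1 + v b) ^ n\<close> and \<open>b ^ m\<close>.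
\<close>

lemma one_le_resolvent_denominator:
  assumes "0 \<le> v" "a \<le> r"
  shows "1 \<le> 1 + v * r"
  using assms a_pos by simp

lemma integrable_power_over_power:
  assumes "0 \<le> v"
  shows "integrable M (\<lambda>r. r ^ m / (1 + v * r) ^ n)"
proof (rule integrable_bounded_on_range[where K = "b ^ m"])
  fix r assume r: "a \<le> r" "r \<le> b"
  have "r ^ m / (1 + v * r) ^ n \<le> r ^ m / 1"
    using one_le_resolvent_denominator[OF assms r(1)] r a_pos
    by (intro divide_left_mono) auto
  also have "\<dots> \<le> b ^ m"
    using r a_pos by (auto intro: power_mono)
  finally show "\<bar>r ^ m / (1 + v * r) ^ n\<bar> \<le> b ^ m"
    using one_le_resolvent_denominator[OF assms r(1)] r a_pos by simp
qed measurable

lemma integral_power_over_power_pos: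
  assumes "0 \<le> v"
  shows "0 < (\<integral>r. r ^ m / (1 + v * r) ^ n \<partial>M)"
proof (rule integral_pos_on_range[OF integrable_power_over_power[OF assms]])
  have b: "1 \<le> 1 + v * b"
    using one_le_resolvent_denominator[OF assms a_le_b] .
  then show "0 < a ^ m / (1 + v * b) ^ n"
    using a_pos by simp
  fix r assume r: "a \<le> r" "r \<le> b"
  have "0 < 1 + v * r"
    using one_le_resolvent_denominator[OF assms r(1)] by linarith
  then show "a ^ m / (1 + v * b) ^ n \<le> r ^ m / (1 + v * r) ^ n"
    using r a_pos b assms
    by (intro frac_le power_mono add_left_mono mult_left_mono zero_le_power zero_less_power) auto
qed

section \<open>The normalised degrees of freedom\<close>

text \<open>
  With \<open>v = 1 / \<kappa>\<close> this is \<open>\<integral> r / (r + \<kappa>) dM\<close>, the effective degrees of freedom per feature of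
  ridge regression with penalty \<open>\<kappa>\<close>.
\<close>
definition dof :: "real \<Rightarrow> real" where
  "dof v = (\<integral>r. v * r / (1 + v * r) \<partial>M)"

lemma dof_eq: "dof v = v * (\<integral>r. r / (1 + v * r) \<partial>M)"
  unfolding dof_def by (subst integral_mult_right_zero[symmetric]) simp

lemma dof_zero [simp]: "dof 0 = 0"
  by (simp add: dof_eq)

lemma integrable_dof:
  assumes "0 \<le> v"
  shows "integrable M (\<lambda>r. v * r / (1 + v * r))"
  using integrable_mult_right[OF integrable_power_over_power[OF assms, of 1 1], of v] by simp

text \<open>
  The two slopes come from
  \<open>v r / (1 + v r) - u r / (1 + u r) = (v - u) r / ((1 + u r) (1 + v r))\<close>. The upper one gives
  continuity, the lower one strict monotonicity and a quantitative control of the inverse.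
\<close>
lemma dof_slope_bounds:
  assumes "0 \<le> u" "u \<le> v"
  shows "(v - u) * (a / (1 + v * b)\<^sup>2) \<le> dof v - dof u"
    and "dof v - dof u \<le> (v - u) * b"
proof -
  let ?d = "\<lambda>r. v * r / (1 + v * r) - u * r / (1 + u * r)"
  have v: "0 \<le> v"
    using assms by simp
  have int: "integrable M ?d"
    using integrable_dof[OF v] integrable_dof[OF assms(1)] by (rule Bochner_Integration.integrable_diff)
  have diff: "dof v - dof u = integral\<^sup>L M ?d"
    unfolding dof_def
    using integrable_dof[OF v] integrable_dof[OF assms(1)]
    by (rule Bochner_Integration.integral_diff[symmetric])
  have bounds: "(v - u) * (a / (1 + v * b)\<^sup>2) \<le> ?d r \<and> ?d r \<le> (v - u) * b"
    if r: "a \<le> r" "r \<le> b" for r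
  proof -
    have pu: "1 \<le> 1 + u * r" and pv: "1 \<le> 1 + v * r"
      using one_le_resolvent_denominator assms(1) v r by auto
    have eq: "?d r = (v - u) * (r / ((1 + u * r) * (1 + v * r)))"
      using pu pv by (simp add: field_simps)
    have ub: "1 + u * r \<le> 1 + v * b" and vb: "1 + v * r \<le> 1 + v * b"
      using assms v r a_pos by (auto intro: mult_mono)
    have "(1 + u * r) * (1 + v * r) \<le> (1 + v * b)\<^sup>2"
      unfolding power2_eq_square using ub vb pu pv by (intro mult_mono) auto
    then have lo: "a / (1 + v * b)\<^sup>2 \<le> r / ((1 + u * r) * (1 + v * r))"
      using r a_pos pu pv by (intro frac_le) auto
    have "1 \<le> (1 + u * r) * (1 + v * r)"
      using mult_mono[OF pu pv] pu by simp
    then have "r / ((1 + u * r) * (1 + v * r)) \<le> r / 1"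
      using r a_pos by (intro divide_left_mono) auto
    then have hi: "r / ((1 + u * r) * (1 + v * r)) \<le> b"
      using r by simp
    show ?thesis
      unfolding eq using lo hi assms by (intro conjI mult_left_mono) auto
  qed
  show "(v - u) * (a / (1 + v * b)\<^sup>2) \<le> dof v - dof u"
    unfolding diff using int bounds by (intro integral_ge_const_on_range) blast+
  have "integral\<^sup>L M ?d \<le> integral\<^sup>L M (\<lambda>_. (v - u) * b)"
    using int bounds by (intro integral_mono_on_range) auto
  then show "dof v - dof u \<le> (v - u) * b"
    unfolding diff by (simp add: prob_space[simplified])
qed

lemma dof_mono: "0 \<le> u \<Longrightarrow> u \<le> v \<Longrightarrow> dof u \<le> dof v"
proof -
  assume uv: "0 \<le> u" "u \<le> v"
  then have "0 \<le> (v - u) * (a / (1 + v * b)\<^sup>2)"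
    using a_pos by simp
  then show "dof u \<le> dof v"
    using dof_slope_bounds(1)[OF uv] by linarith
qed

lemma dof_strict_mono: "0 \<le> u \<Longrightarrow> u < v \<Longrightarrow> dof u < dof v"
proof -
  assume uv: "0 \<le> u" "u < v"
  have "0 < 1 + v * b"
    using one_le_resolvent_denominator[of v b] a_le_b uv by simp
  then have "0 < (v - u) * (a / (1 + v * b)\<^sup>2)"
    using a_pos uv by simp
  then show "dof u < dof v"
    using dof_slope_bounds(1)[of u v] uv by linarith
qed

lemma dof_nonneg: "0 \<le> v \<Longrightarrow> 0 \<le> dof v"
  using dof_mono[of 0 v] by simp

lemma continuous_on_dof: "continuous_on {0..} dof"
proof -
  have "(b)-lipschitz_on {0..} dof"
  proof (rule lipschitz_onI)
    show "0 \<le> b"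
      using a_pos a_le_b by simp
    fix x y :: real assume "x \<in> {0..}" "y \<in> {0..}"
    then have xy: "0 \<le> x" "0 \<le> y"
      by auto
    show "dist (dof x) (dof y) \<le> b * dist x y"
    proof (cases "x \<le> y")
      case True
      then show ?thesis
        using dof_slope_bounds(2)[OF xy(1) True] dof_mono[OF xy(1) True]
        by (simp add: dist_real_def mult.commute)
    next
      case False
      then have "y \<le> x"
        by simp
      then show ?thesis
        using dof_slope_bounds(2)[OF xy(2), of x] dof_mono[OF xy(2), of x]
        by (simp add: dist_real_def mult.commute)
    qed
  qed
  then show ?thesis
    by (rule lipschitz_on_continuous_on)
qed

section \<open>The fixed-point equation\<close>

definition is_ridge_root :: "real \<Rightarrow> real \<Rightarrow> real \<Rightarrow> bool" where
  "is_ridge_root lam \<theta> v \<longleftrightarrow> 0 < v \<and> lam * v + \<theta> * dof v = 1"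

text \<open>
  At a root \<open>v\<close>, the term \<open>lam \<sqdot> v\<close> forces \<open>v \<le> 1 / lam\<close> if \<open>lam > 0\<close>, and for \<open>\<theta> > 1\<close> the
  bound \<open>dof v \<ge> a v / (1 + a v)\<close> forces \<open>v \<le> 1 / ((\<theta> - 1) a)\<close>. The same two values show that the
  left-hand side does reach \<open>1\<close>.
\<close>
lemma ex_ridge_root:
  assumes "0 \<le> lam" "0 < \<theta>" and reg: "0 < lam \<or> 1 < \<theta>"
  shows "\<exists>v. is_ridge_root lam \<theta> v"
proof -
  let ?F = "\<lambda>v. lam * v + \<theta> * dof v"
  have "\<exists>w\<ge>0. 1 \<le> ?F w"
    using reg
  proof
    assume "0 < lam"
    then show ?thesis
      using dof_nonneg[of "1 / lam"] assms(2) by (intro exI[of _ "1 / lam"]) simp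
  next
    assume \<theta>: "1 < \<theta>"
    define w where "w = 1 / ((\<theta> - 1) * a)"
    have w: "0 < w"
      using \<theta> a_pos by (simp add: w_def)
    have wa: "w * a = 1 / (\<theta> - 1)"
      using \<theta> a_pos by (simp add: w_def)
    have eq: "w * a / (1 + w * a) = 1 / \<theta>"
      unfolding wa using \<theta> by (simp add: field_simps)
    have "1 / \<theta> \<le> dof w"
      unfolding dof_def eq[symmetric]
    proof (rule integral_ge_const_on_range[OF integrable_dof])
      fix r assume r: "a \<le> r" "r \<le> b"
      then show "w * a / (1 + w * a) \<le> w * r / (1 + w * r)"
        using w a_pos by (intro div_one_plus_mono mult_left_mono mult_nonneg_nonneg) auto
    qed (use w in simp)
    then have "1 \<le> \<theta> * dof w"
      using \<theta> by (simp add: field_simps)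
    then show ?thesis
      using w assms(1) by (intro exI[of _ w]) (simp add: add_increasing)
  qed
  then obtain w where w: "0 \<le> w" "1 \<le> ?F w"
    by blast
  have "continuous_on {0..w} dof"
    using continuous_on_dof by (rule continuous_on_subset) auto
  then have "continuous_on {0..w} ?F"
    by (intro continuous_intros)
  then obtain v where v: "0 \<le> v" "?F v = 1"
    using IVT'[of ?F 0 1 w] w by auto
  then have "v \<noteq> 0"
    by auto
  with v show ?thesis
    unfolding is_ridge_root_def by (intro exI[of _ v]) simp
qed

text \<open>
  A larger root at a larger penalty would make both summands of the equation larger, the second
  one strictly. The case of equal penalties is uniqueness; the general case compares the root at a
  positive penalty with the one at penalty \<open>0\<close>.
\<close>
lemma ridge_root_antimono:
  assumes "is_ridge_root l \<theta> v" "is_ridge_root l' \<theta> v'" "0 \<le> l" "l \<le> l'" "0 < \<theta>"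
  shows "v' \<le> v"
proof (rule ccontr)
  assume "\<not> v' \<le> v"
  then have less: "v < v'"
    by simp
  have v: "0 < v" "l * v + \<theta> * dof v = 1" and v': "0 < v'" "l' * v' + \<theta> * dof v' = 1"
    using assms(1,2) by (auto simp: is_ridge_root_def)
  have "\<theta> * dof v < \<theta> * dof v'"
    using dof_strict_mono[of v v'] v less assms(5) by simp
  moreover have "l * v \<le> l' * v'"
    using assms(3,4) v less by (intro mult_mono) auto
  ultimately show False
    using v v' by linarith
qed

lemma ridge_root_unique:
  assumes "is_ridge_root l \<theta> v" "is_ridge_root l \<theta> v'" "0 \<le> l" "0 < \<theta>"
  shows "v' = v"
  using ridge_root_antimono[OF assms(1,2)] ridge_root_antimono[OF assms(2,1)] assms by force

lemma ridge_root_iff_fixed_point: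
  assumes "0 < lam" "0 < \<theta>"
  shows "0 \<le> v \<and> 1 / v = lam + \<theta> * (\<integral>r. r / (1 + v * r) \<partial>M) \<longleftrightarrow> is_ridge_root lam \<theta> v"
proof (cases "0 < v")
  case True
  then show ?thesis
    unfolding is_ridge_root_def dof_eq by (auto simp: field_simps)
next
  case False
  \<comment> \<open>At \<open>v = 0\<close> the quotient \<open>1 / v\<close> is \<open>0\<close>, but the right-hand side is positive.\<close>
  have "0 < \<theta> * (\<integral>r. r / (1 + v * r) \<partial>M)" if "v = 0"
    using integral_power_over_power_pos[of v 1 1] assms that by simp
  with False assms show ?thesis
    unfolding is_ridge_root_def by (cases "v = 0") force+
qed

lemma ridge_v_pos_eq_root:
  assumes "0 < lam" "0 < \<theta>" "is_ridge_root lam \<theta> v"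
  shows "ridge_v_pos M lam \<theta> = v"
  unfolding ridge_v_pos_def ridge_root_iff_fixed_point[OF assms(1,2)]
  by (intro the_equality ridge_root_unique[OF assms(3)]) (use assms in simp_all)

text \<open>
  With \<open>w\<close> the root at penalty \<open>0\<close>, a root \<open>v\<close> at penalty \<open>l > 0\<close> satisfies
  \<open>\<theta> (dof w - dof v) = l v \<le> l w\<close>; the slope of \<open>dof\<close> on \<open>[0, w]\<close> is bounded below, hence
  \<open>0 \<le> w - v = O(l)\<close>.
\<close>
lemma ridge_v_pos_tendsto_ridgeless:
  assumes "1 < \<theta>" "is_ridge_root 0 \<theta> w"
  shows "((\<lambda>l. ridge_v_pos M l \<theta>) \<longlongrightarrow> w) (at_right 0)"
proof -
  have \<theta>: "0 < \<theta>"
    using assms by simp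
  have w: "0 < w" "\<theta> * dof w = 1"
    using assms(2) by (auto simp: is_ridge_root_def)
  define k where "k = \<theta> * (a / (1 + w * b)\<^sup>2)"
  have "0 < 1 + w * b"
    using one_le_resolvent_denominator[of w b] a_le_b w by simp
  then have k: "0 < k"
    using \<theta> a_pos by (simp add: k_def)
  have bounds: "w - l * w / k \<le> ridge_v_pos M l \<theta> \<and> ridge_v_pos M l \<theta> \<le> w" if l: "0 < l" for l
  proof -
    obtain v where root: "is_ridge_root l \<theta> v"
      using ex_ridge_root[of l \<theta>] l \<theta> by auto
    then have v: "0 < v" "l * v + \<theta> * dof v = 1"
      by (auto simp: is_ridge_root_def)
    have vw: "v \<le> w"
      using ridge_root_antimono[OF assms(2) root] l \<theta> by simp
    have "(w - v) * k = \<theta> * ((w - v) * (a / (1 + w * b)\<^sup>2))"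
      by (simp add: k_def)
    also have "\<dots> \<le> \<theta> * (dof w - dof v)"
      using dof_slope_bounds(1)[of v w] v vw \<theta> by (intro mult_left_mono) auto
    also have "\<dots> = l * v"
      using v(2) w(2) by (simp add: algebra_simps)
    also have "\<dots> \<le> l * w"
      using vw l by simp
    finally have "w - v \<le> l * w / k"
      using k by (simp add: field_simps)
    then show ?thesis
      using vw ridge_v_pos_eq_root[OF l \<theta> root] by simp
  qed
  have "((\<lambda>l. w - l * w / k) \<longlongrightarrow> w - 0 * w / k) (at_right 0)"
    using k by (intro tendsto_intros) auto
  then have "((\<lambda>l. w - l * w / k) \<longlongrightarrow> w) (at_right 0)"
    by simp
  then show ?thesis
  proof (rule tendsto_sandwich[rotated 2, OF _ tendsto_const])
    show "\<forall>\<^sub>F l in at_right 0. w - l * w / k \<le> ridge_v_pos M l \<theta>"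
      using bounds by (auto simp: eventually_at_filter)
    show "\<forall>\<^sub>F l in at_right 0. ridge_v_pos M l \<theta> \<le> w"
      using bounds by (auto simp: eventually_at_filter)
  qed
qed

lemma ridge_v_root:
  assumes "0 \<le> lam" "0 < \<theta>" "0 < lam \<or> 1 < \<theta>"
  obtains v where "is_ridge_root lam \<theta> v" "ridge_v M lam (ereal \<theta>) = ereal v"
proof -
  obtain v where v: "is_ridge_root lam \<theta> v"
    using ex_ridge_root[OF assms] ..
  have "ridge_v M lam (ereal \<theta>) = ereal v"
  proof (cases "0 < lam")
    case True
    then show ?thesis
      using ridge_v_pos_eq_root[OF True assms(2) v] by (simp add: ridge_v_def)
  next
    case False
    then have "lam = 0" "1 < \<theta>"
      using assms by auto
    with ridge_v_pos_tendsto_ridgeless[of \<theta> v] v have "Lim (at_right 0) (\<lambda>l. ridge_v_pos M l \<theta>) = v"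
      by (intro tendsto_Lim) auto
    with False \<open>1 < \<theta>\<close> show ?thesis
      by (simp add: ridge_v_def)
  qed
  with v show thesis
    by (rule that)
qed

text \<open>
  With \<open>s = v r / (1 + v r) \<le> q < 1\<close> on the spectrum, \<open>\<theta> \<integral> s\<^sup>2 \<le> q \<theta> \<integral> s \<le> q\<close>, the last step being
  the fixed-point equation.
\<close>
lemma ridge_root_denominator:
  assumes "is_ridge_root lam \<theta> v" "0 \<le> lam" "0 < \<theta>"
  shows "\<theta> * (\<integral>r. r\<^sup>2 / (1 + v * r)\<^sup>2 \<partial>M) < 1 / v\<^sup>2"
proof -
  let ?J = "\<integral>r. r\<^sup>2 / (1 + v * r)\<^sup>2 \<partial>M"
  have v: "0 < v" "lam * v + \<theta> * dof v = 1"
    using assms by (auto simp: is_ridge_root_def)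
  define q where "q = v * b / (1 + v * b)"
  have vb: "0 < v * b"
    using v a_pos a_le_b by simp
  then have q: "0 < q" "q < 1"
    by (auto simp: q_def)
  have "v\<^sup>2 * ?J = (\<integral>r. v\<^sup>2 * (r\<^sup>2 / (1 + v * r)\<^sup>2) \<partial>M)"
    by (rule integral_mult_right_zero[symmetric])
  also have "\<dots> \<le> (\<integral>r. q * (v * r / (1 + v * r)) \<partial>M)"
  proof (rule integral_mono_on_range)
    show "integrable M (\<lambda>r. v\<^sup>2 * (r\<^sup>2 / (1 + v * r)\<^sup>2))"
      using integrable_power_over_power[of v 2 2] v by (intro integrable_mult_right) simp
    show "integrable M (\<lambda>r. q * (v * r / (1 + v * r)))"
      using integrable_dof[of v] v by (intro integrable_mult_right) simp
    fix r assume r: "a \<le> r" "r \<le> b"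
    define s where "s = v * r / (1 + v * r)"
    have p: "1 \<le> 1 + v * r"
      using one_le_resolvent_denominator[of v r] v r by simp
    have "s \<le> q"
      unfolding s_def q_def using v r a_pos
      by (intro div_one_plus_mono mult_left_mono mult_nonneg_nonneg) auto
    moreover have "0 \<le> s"
      using p by (simp add: s_def)
    ultimately have "s\<^sup>2 \<le> q * s"
      unfolding power2_eq_square by (rule mult_right_mono)
    then show "v\<^sup>2 * (r\<^sup>2 / (1 + v * r)\<^sup>2) \<le> q * (v * r / (1 + v * r))"
      by (simp add: s_def power_divide power_mult_distrib)
  qed
  also have "\<dots> = q * dof v"
    unfolding dof_def by (rule integral_mult_right_zero)
  finally have "\<theta> * (v\<^sup>2 * ?J) \<le> \<theta> * (q * dof v)"
    using assms(3) by simp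
  also have "\<dots> = q * (\<theta> * dof v)"
    by simp
  also have "\<dots> \<le> q * 1"
  proof (rule mult_left_mono)
    have "0 \<le> lam * v"
      using assms(2) v(1) by simp
    then show "\<theta> * dof v \<le> 1"
      using v(2) by linarith
  qed (use q in simp)
  also have "\<dots> < 1"
    using q by simp
  finally show ?thesis
    using v(1) by (simp add: field_simps)
qed

lemma ridge_v_tilde_pos:
  assumes "0 \<le> lam" "0 < \<theta>" "0 < lam \<or> 1 < \<theta>"
  shows "0 < ridge_v_tilde M lam (ereal \<theta>) (ereal \<theta>)"
proof -
  obtain v where v: "is_ridge_root lam \<theta> v" "ridge_v M lam (ereal \<theta>) = ereal v"
    using ridge_v_root[OF assms] .
  have "0 < \<theta> * (\<integral>r. r\<^sup>2 / (1 + v * r)\<^sup>2 \<partial>M)"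
    using integral_power_over_power_pos[of v 2 2] v(1) assms(2) by (simp add: is_ridge_root_def)
  then show ?thesis
    using ridge_root_denominator[OF v(1) assms(1,2)]
    by (simp add: ridge_v_tilde_def v(2) Let_def)
qed

lemma ridge_c_tilde_pos:
  assumes "0 \<le> real_of_ereal (ridge_v H lam \<theta>)"
  shows "0 < ridge_c_tilde H M lam \<theta>"
  using integral_power_over_power_pos[OF assms, of 1 2] by (simp add: ridge_c_tilde_def Let_def)

end

section \<open>Signs of the risk components\<close>

locale ridge_limit =
  H: bounded_spectrum H a b + G: bounded_spectrum G a b for H G a b +
  fixes lam :: real and \<theta> :: ereal
  assumes lam_nonneg: "0 \<le> lam" and \<theta>_pos: "0 < \<theta>"
begin

text \<open>
  The case \<open>lam = 0\<close>, \<open>\<theta> \<le> 1\<close> is excluded because the components are then given by values of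
  their own; there \<open>ridge_v\<close> is infinite. At \<open>\<theta> = \<infinity>\<close> equality \<open>v_tilde = 0\<close> holds.
\<close>
lemma tilde_signs:
  assumes "\<not> (lam = 0 \<and> \<theta> \<le> 1)"
  shows "0 \<le> ridge_v_tilde H lam \<theta> \<theta>"
    and "\<theta> < \<infinity> \<Longrightarrow> 0 < ridge_v_tilde H lam \<theta> \<theta>"
    and "0 < ridge_c_tilde H G lam \<theta>"
proof -
  have "0 \<le> ridge_v_tilde H lam \<theta> \<theta> \<and> (\<theta> < \<infinity> \<longrightarrow> 0 < ridge_v_tilde H lam \<theta> \<theta>) \<and>
    0 < ridge_c_tilde H G lam \<theta>"
  proof (cases \<theta>)
    case (real t)
    then have t: "0 < t" "0 < lam \<or> 1 < t"
      using \<theta>_pos lam_nonneg assms by (auto simp: not_le)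
    obtain v where "H.is_ridge_root lam t v" "ridge_v H lam (ereal t) = ereal v"
      using H.ridge_v_root[OF lam_nonneg t] .
    then have "0 \<le> real_of_ereal (ridge_v H lam \<theta>)"
      by (simp add: real H.is_ridge_root_def)
    then show ?thesis
      using G.ridge_c_tilde_pos H.ridge_v_tilde_pos[OF lam_nonneg t] by (simp add: real)
  next
    case PInf
    then show ?thesis
      using G.ridge_c_tilde_pos[of H lam \<theta>] by (simp add: ridge_v_tilde_def ridge_v_def)
  next
    case MInf
    then show ?thesis
      using \<theta>_pos by simp
  qed
  then show "0 \<le> ridge_v_tilde H lam \<theta> \<theta>"
    and "\<theta> < \<infinity> \<Longrightarrow> 0 < ridge_v_tilde H lam \<theta> \<theta>" and "0 < ridge_c_tilde H G lam \<theta>"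
    by auto
qed

lemma B_comp_ge_C_comp:
  obtains B C where "B_comp H G \<rho> lam \<theta> \<theta> = ereal B" "C_comp H G \<rho> lam \<theta> = ereal C" "C \<le> B"
    "0 < \<rho>\<^sup>2 \<Longrightarrow> \<theta> < \<infinity> \<Longrightarrow> (lam = 0 \<longrightarrow> 1 < \<theta>) \<Longrightarrow> C < B"
proof (cases "lam = 0 \<and> \<theta> \<le> 1")
  case True
  then show ?thesis
    by (intro that[of 0 0]) (auto simp: B_comp_def C_comp_def zero_ereal_def)
next
  case False
  let ?v = "ridge_v_tilde H lam \<theta> \<theta>" and ?c = "ridge_c_tilde H G lam \<theta>"
  note signs = tilde_signs[OF False]
  show ?thesis
  proof (rule that)
    show "B_comp H G \<rho> lam \<theta> \<theta> = ereal (\<rho>\<^sup>2 * (1 + ?v) * ?c)" "C_comp H G \<rho> lam \<theta> = ereal (\<rho>\<^sup>2 * ?c)"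
      using False by (auto simp: B_comp_def C_comp_def)
    have split: "\<rho>\<^sup>2 * (1 + ?v) * ?c = \<rho>\<^sup>2 * ?c + \<rho>\<^sup>2 * ?v * ?c"
      by (simp add: algebra_simps)
    show "\<rho>\<^sup>2 * ?c \<le> \<rho>\<^sup>2 * (1 + ?v) * ?c"
      unfolding split using signs by simp
    show "\<rho>\<^sup>2 * ?c < \<rho>\<^sup>2 * (1 + ?v) * ?c" if "0 < \<rho>\<^sup>2" "\<theta> < \<infinity>"
      unfolding split using signs that by simp
  qed
qed

lemma V_comp_nonneg: "0 \<le> V_comp H \<sigma> lam \<theta> \<theta>"
proof (cases "lam = 0 \<and> \<theta> \<le> 1")
  case True
  then show ?thesis
    using \<theta>_pos by (cases \<theta>) (auto simp: V_comp_def one_ereal_def)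
next
  case False
  then show ?thesis
    using tilde_signs(1)[OF False] by (auto simp: V_comp_def)
qed

lemma V_comp_pos:
  assumes "0 < \<sigma>\<^sup>2" "\<theta> < \<infinity>" "lam = 0 \<longrightarrow> \<theta> \<noteq> 1"
  obtains V where "V_comp H \<sigma> lam \<theta> \<theta> = ereal V" "0 < V"
proof (cases "lam = 0 \<and> \<theta> \<le> 1")
  case True
  with \<theta>_pos assms obtain t where t: "\<theta> = ereal t" "0 < t" "t < 1"
    by (cases \<theta>) (auto simp: one_ereal_def)
  show ?thesis
  proof (rule that)
    show "V_comp H \<sigma> lam \<theta> \<theta> = ereal (\<sigma>\<^sup>2 * (t / (1 - t)))"
      using True t assms(3) by (simp add: V_comp_def)
    show "0 < \<sigma>\<^sup>2 * (t / (1 - t))"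
      using assms(1) t by simp
  qed
next
  case False
  show ?thesis
  proof (rule that)
    show "V_comp H \<sigma> lam \<theta> \<theta> = ereal (\<sigma>\<^sup>2 * ridge_v_tilde H lam \<theta> \<theta>)"
      using False by (auto simp: V_comp_def)
    show "0 < \<sigma>\<^sup>2 * ridge_v_tilde H lam \<theta> \<theta>"
      using assms tilde_signs(2)[OF False] by simp
  qed
qed

end

section \<open>Dependence on the number of bags\<close>

text \<open>
  The inverse number of bags as a real number. Division gives \<open>bag_weight 0 = 0\<close>, whereas the inverse
  of \<open>0\<close> in the extended reals is \<open>\<infinity>\<close>; hence the lower bounds \<open>1 \<le> k\<close> below.
\<close>
definition bag_weight :: "enat \<Rightarrow> real" where
  "bag_weight k = (case k of enat n \<Rightarrow> 1 / real n | \<infinity> \<Rightarrow> 0)"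

lemma inverse_ereal_of_enat_eq_bag_weight:
  assumes "1 \<le> k"
  shows "inverse (ereal_of_enat k) = ereal (bag_weight k)"
  using assms by (cases k) (auto simp: bag_weight_def one_enat_def divide_inverse zero_ereal_def)

lemma bag_weight_strict_antimono:
  assumes "1 \<le> j" "j < k"
  shows "bag_weight k < bag_weight j"
  using assms
  by (cases j; cases k) (auto simp: bag_weight_def one_enat_def intro!: divide_strict_left_mono)

lemma bag_weight_antimono:
  assumes "1 \<le> j" "j \<le> k"
  shows "bag_weight k \<le> bag_weight j"
  using bag_weight_strict_antimono[of j k] assms
  by (cases "j = k") (auto simp: order_le_less)

lemma one_le_num_splits:
  assumes "0 < \<phi>" "ereal \<phi> \<le> \<phi>s"
  shows "1 \<le> num_splits \<phi> \<phi>s"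
proof (cases \<phi>s)
  case (real t)
  with assms have "1 \<le> t / \<phi>"
    by simp
  then have "1 \<le> nat \<lfloor>t / \<phi>\<rfloor>"
    by (simp add: le_nat_iff le_floor_iff)
  then show ?thesis
    by (simp add: num_splits_def real one_enat_def)
qed (use assms in \<open>auto simp: num_splits_def\<close>)

lemma B_spl_affine:
  assumes "1 \<le> min M (num_splits \<phi> \<phi>s)"
    and "B_comp H G \<rho> lam \<phi>s \<phi>s = ereal B" "C_comp H G \<rho> lam \<phi>s = ereal C"
  shows "B_spl H G \<rho> lam M \<phi> \<phi>s = ereal (C + bag_weight (min M (num_splits \<phi> \<phi>s)) * (B - C))"
  unfolding B_spl_def Let_def inverse_ereal_of_enat_eq_bag_weight[OF assms(1)] assms(2,3)
  by (simp add: one_ereal_def algebra_simps)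

lemma V_spl_linear:
  assumes "1 \<le> min M (num_splits \<phi> \<phi>s)"
  shows "V_spl H \<sigma> lam M \<phi> \<phi>s
    = ereal (bag_weight (min M (num_splits \<phi> \<phi>s))) * V_comp H \<sigma> lam \<phi>s \<phi>s"
  unfolding V_spl_def inverse_ereal_of_enat_eq_bag_weight[OF assms] ..

locale split_ridge_limit = ridge_limit H G a b lam \<phi>s for H G a b lam \<phi>s +
  fixes \<phi> :: real
  assumes \<phi>_pos: "0 < \<phi>" and \<phi>_le: "ereal \<phi> \<le> \<phi>s"
begin

lemma one_le_min_num_splits: "1 \<le> j \<Longrightarrow> 1 \<le> min j (num_splits \<phi> \<phi>s)"
  using one_le_num_splits[OF \<phi>_pos \<phi>_le] by simp

lemma B_spl_antimono:
  assumes "1 \<le> j" "j \<le> k"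
  shows "B_spl H G \<rho> lam k \<phi> \<phi>s \<le> B_spl H G \<rho> lam j \<phi> \<phi>s"
proof -
  obtain B C where BC: "B_comp H G \<rho> lam \<phi>s \<phi>s = ereal B" "C_comp H G \<rho> lam \<phi>s = ereal C" "C \<le> B"
    using B_comp_ge_C_comp by metis
  have jk: "1 \<le> j" "1 \<le> k"
    using assms by auto
  have "bag_weight (min k (num_splits \<phi> \<phi>s)) \<le> bag_weight (min j (num_splits \<phi> \<phi>s))"
    using assms one_le_min_num_splits by (intro bag_weight_antimono min.mono) auto
  then have "bag_weight (min k (num_splits \<phi> \<phi>s)) * (B - C)
      \<le> bag_weight (min j (num_splits \<phi> \<phi>s)) * (B - C)"
    using BC(3) by (intro mult_right_mono) auto
  then show ?thesis
    using jk[THEN one_le_min_num_splits] BC by (simp add: B_spl_affine)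
qed

lemma B_spl_strict_antimono:
  assumes "1 \<le> j" "j < k" "k \<le> num_splits \<phi> \<phi>s"
    and "0 < \<rho>\<^sup>2" "\<phi>s < \<infinity>" "lam = 0 \<longrightarrow> 1 < \<phi>s"
  shows "B_spl H G \<rho> lam k \<phi> \<phi>s < B_spl H G \<rho> lam j \<phi> \<phi>s"
proof -
  obtain B C where BC: "B_comp H G \<rho> lam \<phi>s \<phi>s = ereal B" "C_comp H G \<rho> lam \<phi>s = ereal C" "C < B"
    using B_comp_ge_C_comp assms(4-6) by metis
  have jk: "1 \<le> j" "1 \<le> k"
    using assms by auto
  have mins: "min j (num_splits \<phi> \<phi>s) = j" "min k (num_splits \<phi> \<phi>s) = k"
    using assms by (auto simp: min_def)
  have "bag_weight k * (B - C) < bag_weight j * (B - C)"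
    using bag_weight_strict_antimono[OF assms(1,2)] BC(3) by (intro mult_strict_right_mono) auto
  then show ?thesis
    using jk[THEN one_le_min_num_splits] BC by (simp add: B_spl_affine mins)
qed

lemma V_spl_antimono:
  assumes "1 \<le> j" "j \<le> k"
  shows "V_spl H \<sigma> lam k \<phi> \<phi>s \<le> V_spl H \<sigma> lam j \<phi> \<phi>s"
proof -
  have jk: "1 \<le> j" "1 \<le> k"
    using assms by auto
  have "bag_weight (min k (num_splits \<phi> \<phi>s)) \<le> bag_weight (min j (num_splits \<phi> \<phi>s))"
    using assms one_le_min_num_splits by (intro bag_weight_antimono min.mono) auto
  then show ?thesis
    unfolding jk[THEN one_le_min_num_splits, THEN V_spl_linear]
    using V_comp_nonneg by (intro ereal_mult_right_mono) auto
qed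

lemma V_spl_strict_antimono:
  assumes "1 \<le> j" "j < k" "k \<le> num_splits \<phi> \<phi>s"
    and "0 < \<sigma>\<^sup>2" "\<phi>s < \<infinity>" "lam = 0 \<longrightarrow> \<phi>s \<noteq> 1"
  shows "V_spl H \<sigma> lam k \<phi> \<phi>s < V_spl H \<sigma> lam j \<phi> \<phi>s"
proof -
  obtain V where V: "V_comp H \<sigma> lam \<phi>s \<phi>s = ereal V" "0 < V"
    using V_comp_pos[OF assms(4-6)] .
  have jk: "1 \<le> j" "1 \<le> k"
    using assms by auto
  have mins: "min j (num_splits \<phi> \<phi>s) = j" "min k (num_splits \<phi> \<phi>s) = k"
    using assms by (auto simp: min_def)
  show ?thesis
    unfolding jk[THEN one_le_min_num_splits, THEN V_spl_linear] mins V(1)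
    using bag_weight_strict_antimono[OF assms(1,2)] V(2) by simp
qed

lemma R_spl_antimono:
  assumes "1 \<le> j" "j \<le> k"
  shows "R_spl H G \<rho> \<sigma> lam k \<phi> \<phi>s \<le> R_spl H G \<rho> \<sigma> lam j \<phi> \<phi>s"
  unfolding R_spl_def using assms by (intro add_mono B_spl_antimono V_spl_antimono) auto

text \<open>
  One step beyond the cap changes nothing, which is why the comparison with the value at the cap
  covers \<open>M + 1\<close> even for \<open>M\<close> equal to the cap.
\<close>
lemma spl_at_cap_le:
  assumes "1 \<le> j"
  shows "B_spl H G \<rho> lam (num_splits \<phi> \<phi>s) \<phi> \<phi>s \<le> B_spl H G \<rho> lam j \<phi> \<phi>s"
    and "V_spl H \<sigma> lam (num_splits \<phi> \<phi>s) \<phi> \<phi>s \<le> V_spl H \<sigma> lam j \<phi> \<phi>s"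
proof -
  let ?N = "num_splits \<phi> \<phi>s"
  have cap: "B_spl H G \<rho> lam (min j ?N) \<phi> \<phi>s = B_spl H G \<rho> lam j \<phi> \<phi>s"
    "V_spl H \<sigma> lam (min j ?N) \<phi> \<phi>s = V_spl H \<sigma> lam j \<phi> \<phi>s"
    by (simp_all add: B_spl_def V_spl_def min.assoc)
  have "1 \<le> min j ?N" "min j ?N \<le> ?N"
    using one_le_min_num_splits[OF assms] by auto
  then show "B_spl H G \<rho> lam ?N \<phi> \<phi>s \<le> B_spl H G \<rho> lam j \<phi> \<phi>s"
    and "V_spl H \<sigma> lam ?N \<phi> \<phi>s \<le> V_spl H \<sigma> lam j \<phi> \<phi>s"
    using B_spl_antimono V_spl_antimono unfolding cap[symmetric] by blast+
qed

end

section \<open>Monotonicity of the split-bagged risk\<close>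

theorem proposition3p10:
  fixes H G :: "real measure"
    and r_min r_max \<rho> \<sigma> lam \<phi> :: real
    and \<phi>s :: ereal
  assumes "0 < r_min" and "r_min \<le> r_max"
    and "real_distribution H" and "AE r in H. r \<in> {r_min..r_max}"
    and "real_distribution G" and "AE r in G. r \<in> {r_min..r_max}"
    and "0 \<le> lam"
    and "0 < \<phi>" and "ereal \<phi> \<le> \<phi>s"
  defines "N \<equiv> num_splits \<phi> \<phi>s"
  shows
    "(\<forall>M::nat. 1 \<le> M \<and> enat M \<le> N \<longrightarrow>
        B_spl H G \<rho> lam N \<phi> \<phi>s \<le> B_spl H G \<rho> lam (enat (M + 1)) \<phi> \<phi>s \<and>
        B_spl H G \<rho> lam (enat (M + 1)) \<phi> \<phi>s \<le> B_spl H G \<rho> lam (enat M) \<phi> \<phi>s \<and>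
        V_spl H \<sigma> lam N \<phi> \<phi>s \<le> V_spl H \<sigma> lam (enat (M + 1)) \<phi> \<phi>s \<and>
        V_spl H \<sigma> lam (enat (M + 1)) \<phi> \<phi>s \<le> V_spl H \<sigma> lam (enat M) \<phi> \<phi>s)
     \<and> (\<rho>\<^sup>2 > 0 \<and> ereal \<phi> < \<phi>s \<and> \<phi>s < \<infinity> \<and> (lam = 0 \<longrightarrow> 1 < \<phi>s) \<longrightarrow>
         (\<forall>M::nat. 1 \<le> M \<and> enat M \<le> N \<longrightarrow>
            (enat (M + 1) < N \<longrightarrow>
               B_spl H G \<rho> lam N \<phi> \<phi>s < B_spl H G \<rho> lam (enat (M + 1)) \<phi> \<phi>s) \<and>
            (enat M < N \<longrightarrow>
               B_spl H G \<rho> lam (enat (M + 1)) \<phi> \<phi>s < B_spl H G \<rho> lam (enat M) \<phi> \<phi>s)))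
     \<and> (\<sigma>\<^sup>2 > 0 \<and> ereal \<phi> < \<phi>s \<and> \<phi>s < \<infinity> \<and> (lam = 0 \<longrightarrow> \<phi>s \<noteq> 1) \<longrightarrow>
         (\<forall>M::nat. 1 \<le> M \<and> enat M \<le> N \<longrightarrow>
            (enat (M + 1) < N \<longrightarrow>
               V_spl H \<sigma> lam N \<phi> \<phi>s < V_spl H \<sigma> lam (enat (M + 1)) \<phi> \<phi>s) \<and>
            (enat M < N \<longrightarrow>
               V_spl H \<sigma> lam (enat (M + 1)) \<phi> \<phi>s < V_spl H \<sigma> lam (enat M) \<phi> \<phi>s)))
     \<and> (\<forall>M::nat. 1 \<le> M \<longrightarrow>
          R_spl H G \<rho> \<sigma> lam (enat (M + 1)) \<phi> \<phi>s \<le> R_spl H G \<rho> \<sigma> lam (enat M) \<phi> \<phi>s)"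
proof -
  have "0 < \<phi>s"
    using assms(8,9) by (metis ereal_less(2) less_le_trans)
  then interpret split_ridge_limit H G r_min r_max lam \<phi>s \<phi>
    using assms
    by (intro split_ridge_limit.intro ridge_limit.intro bounded_spectrum.intro
        bounded_spectrum_axioms.intro ridge_limit_axioms.intro split_ridge_limit_axioms.intro)
  have steps: "1 \<le> enat M" "enat M \<le> enat (M + 1)" "1 \<le> enat (M + 1)" "enat M < enat (M + 1)"
    if "1 \<le> M" for M :: nat
    using that by (auto simp: one_enat_def)
  have Suc_le_cap: "enat (M + 1) \<le> N" if "enat M < N" for M
    using that by (cases N) auto
  have B_strict: "enat (M + 1) < N \<Longrightarrow> B_spl H G \<rho> lam N \<phi> \<phi>s < B_spl H G \<rho> lam (enat (M + 1)) \<phi> \<phi>s"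
    "enat M < N \<Longrightarrow> B_spl H G \<rho> lam (enat (M + 1)) \<phi> \<phi>s < B_spl H G \<rho> lam (enat M) \<phi> \<phi>s"
    if "1 \<le> M" "0 < \<rho>\<^sup>2" "\<phi>s < \<infinity>" "lam = 0 \<longrightarrow> 1 < \<phi>s" for M
  proof -
    show "B_spl H G \<rho> lam N \<phi> \<phi>s < B_spl H G \<rho> lam (enat (M + 1)) \<phi> \<phi>s" if "enat (M + 1) < N"
      using that unfolding N_def
      by (rule B_spl_strict_antimono[OF steps(3)[OF \<open>1 \<le> M\<close>] _ order_refl]) fact+
    show "B_spl H G \<rho> lam (enat (M + 1)) \<phi> \<phi>s < B_spl H G \<rho> lam (enat M) \<phi> \<phi>s" if "enat M < N"
      using Suc_le_cap[OF that] unfolding N_def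
      by (rule B_spl_strict_antimono[OF steps(1,4)[OF \<open>1 \<le> M\<close>]]) fact+
  qed
  have V_strict: "enat (M + 1) < N \<Longrightarrow> V_spl H \<sigma> lam N \<phi> \<phi>s < V_spl H \<sigma> lam (enat (M + 1)) \<phi> \<phi>s"
    "enat M < N \<Longrightarrow> V_spl H \<sigma> lam (enat (M + 1)) \<phi> \<phi>s < V_spl H \<sigma> lam (enat M) \<phi> \<phi>s"
    if "1 \<le> M" "0 < \<sigma>\<^sup>2" "\<phi>s < \<infinity>" "lam = 0 \<longrightarrow> \<phi>s \<noteq> 1" for M
  proof -
    show "V_spl H \<sigma> lam N \<phi> \<phi>s < V_spl H \<sigma> lam (enat (M + 1)) \<phi> \<phi>s" if "enat (M + 1) < N"
      using that unfolding N_def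
      by (rule V_spl_strict_antimono[OF steps(3)[OF \<open>1 \<le> M\<close>] _ order_refl]) fact+
    show "V_spl H \<sigma> lam (enat (M + 1)) \<phi> \<phi>s < V_spl H \<sigma> lam (enat M) \<phi> \<phi>s" if "enat M < N"
      using Suc_le_cap[OF that] unfolding N_def
      by (rule V_spl_strict_antimono[OF steps(1,4)[OF \<open>1 \<le> M\<close>]]) fact+
  qed
  show ?thesis
    using B_spl_antimono[OF steps(1,2)] V_spl_antimono[OF steps(1,2)] R_spl_antimono[OF steps(1,2)]
      spl_at_cap_le[OF steps(3), folded N_def] B_strict V_strict
    by simp
qed

end
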